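(* Let $\lambda>0$, $L=\begin{bmatrix}0&1\\-\lambda&0\end{bmatrix}$, $r\ge1$, $\Delta t=T/N$, and let $N^4,N^5\in\mathbb{R}^{(r+1)\times(r+1)}$ be the matrices of the DG1 scheme defined in the context. Consider an $s$-stage Runge–Kutta method with coefficients $A=\{a_{ij}\}\in\mathbb{R}^{s\times s}$ and $\bm b=(b_1,\dots,b_s)$. Assume that $s=r+1$, $N^4=\Delta t A$, $b_i=a_{s,i}$ for $i=1,\dots,s$, that the matrix $N^5$ is zero up to the last column, which has all entries equal to $-1$, and that the matrix $I_s\otimes I_2-N^4\otimes L$ is invertible. Let $(\widehat{\bm z}_n)_n$ be generated by the DG1 scheme $$(I_{r+1}\otimes I_2-N^4\otimes L)\,\widehat{\bm z}_{n+1}=-(N^5\otimes I_2)\,\widehat{\bm z}_n,\qquad n=0,\dots,N-1,$$ from $\widehat{\bm z}_0\in\mathbb{R}^{2(r+1)}$, and let $(\bm k_n,\bm z_n)_n$ be generated by the Runge–Kutta method applied to $\dot{\bm z}=L\bm z$ from $\bm z_0\in\mathbb{R}^2$. If $[\widehat{\bm z}_0]_{2r+1,2r+2}=\bm z_0$, then $$[\widehat{\bm z}_n]_{2r+1,2r+2}=\bm z_n\quad\text{and}\quad \widehat{\bm z}_n=(I_{r+1}\otimes L^{-1})\,\bm k_{n-1}\qquad\text{for } n=1,\dots,N.$$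
   Context: $\otimes$ is the Kronecker product, $I_m$ the $m\times m$ identity, and $[\bm x]_{2r+1,2r+2}\in\mathbb{R}^2$ denotes the vector of the last two components of $\bm x\in\mathbb{R}^{2(r+1)}$. Runge–Kutta method for $\dot{\bm z}=L\bm z$: the stages $\bm k_{i,n}\in\mathbb{R}^2$ satisfy $\bm k_{i,n}=L\bigl(\bm z_n+\Delta t\sum_{j=1}^sa_{ij}\bm k_{j,n}\bigr)$, $i=1,\dots,s$, and $\bm z_{n+1}=\bm z_n+\Delta t\sum_{i=1}^sb_i\bm k_{i,n}$; with $\bm k_n=[\bm k_{1,n}^\top,\dots,\bm k_{s,n}^\top]^\top$ the stage equations read $(I_s\otimes I_2-\Delta tA\otimes L)\bm k_n=\bm 1\otimes L\bm z_n$, $\bm1=(1,\dots,1)^\top\in\mathbb{R}^s$. DG1 scheme: with $t_n=n\Delta t$, $I_n=(t_{n-1},t_n]$ and a basis $\psi_{n,1},\dots,\psi_{n,r+1}$ of $\mathbb{P}^r(I_n)$ (the same on each slab up to translation), let $N^0_{ij}=-\psi_{n,j}(t_n)\psi_{n+1,i}(t_n)$, $N^1_{ij}=\int_{I_{n+1}}\dot\psi_{n+1,j}\psi_{n+1,i}\,dt$, $N^2_{ij}=\int_{I_{n+1}}\psi_{n+1,j}\psi_{n+1,i}\,dt$, $N^3_{ij}=\psi_{n+1,j}(t_n)\psi_{n+1,i}(t_n)$ (integrals possibly evaluated by a quadrature formula), and $N^4=(N^1+N^3)^{-1}N^2$, $N^5=(N^1+N^3)^{-1}N^0$. The superscripts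 are labels, not powers. The vector $\widehat{\bm z}_n=[u_{n,1},w_{n,1},\dots,u_{n,r+1},w_{n,r+1}]^\top$ contains the coefficients on $I_n$ of the DG approximation of $\dot u=w$, $\dot w=-\lambda u$. *)

theory Defs
  imports
    "HOL-Analysis.Henstock_Kurzweil_Integration"
    "Jordan_Normal_Form.Gauss_Jordan_Elimination"
    "HOL-Computational_Algebra.Polynomial"
begin

no_notation Finite_Cartesian_Product.vec_nth (infixl \<open>$\<close> 90)

text \<open>
  Matrices and vectors are those of \<^theory>\<open>Jordan_Normal_Form.Matrix\<close>, whose entries are
  indexed from 0; every index below is therefore one less than in the usual 1-based notation
  (the slab index \<open>n\<close> is not shifted).
\<close>

definition kronecker :: "real mat \<Rightarrow> real mat \<Rightarrow> real mat" where
  "kronecker A B = mat (dim_row A * dim_row B) (dim_col A * dim_col B)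
     (\<lambda>(i, j). A $$ (i div dim_row B, j div dim_col B) * B $$ (i mod dim_row B, j mod dim_col B))"

text \<open>Only meaningful if \<open>A\<close> is invertible; otherwise an unspecified matrix.\<close>

definition mat_inv :: "real mat \<Rightarrow> real mat" where
  "mat_inv A = the (mat_inverse A)"

definition osc_mat :: "real \<Rightarrow> real mat" where
  "osc_mat lam = mat_of_rows_list 2 [[0, 1], [- lam, 0]]"


subsection \<open>Runge--Kutta methods\<close>

text \<open>\<open>N\<close> steps of size \<open>dt\<close> for \<open>z' = L z\<close>; \<open>k n i\<close> is the stage \<open>i\<close> of the step from \<open>z n\<close>
  to \<open>z (n + 1)\<close>.\<close>

definition runge_kutta ::
  "nat \<Rightarrow> real mat \<Rightarrow> real vec \<Rightarrow> real mat \<Rightarrow> real \<Rightarrow> nat \<Rightarrow>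
   (nat \<Rightarrow> nat \<Rightarrow> real vec) \<Rightarrow> (nat \<Rightarrow> real vec) \<Rightarrow> bool" where
  "runge_kutta s A b L dt N k z \<longleftrightarrow>
     (\<forall>n\<le>N. z n \<in> carrier_vec 2) \<and>
     (\<forall>n<N. \<forall>i<s. k n i \<in> carrier_vec 2) \<and>
     (\<forall>n<N. \<forall>i<s. k n i =
        L *\<^sub>v (z n + dt \<cdot>\<^sub>v finsum_vec TYPE(real) 2 (\<lambda>j. A $$ (i, j) \<cdot>\<^sub>v k n j) {..<s})) \<and>
     (\<forall>n<N. z (Suc n) = z n + dt \<cdot>\<^sub>v finsum_vec TYPE(real) 2 (\<lambda>i. b $ i \<cdot>\<^sub>v k n i) {..<s})"

definition stacked :: "nat \<Rightarrow> (nat \<Rightarrow> real vec) \<Rightarrow> real vec" where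
  "stacked s k = vec (s * 2) (\<lambda>p. k (p div 2) $ (p mod 2))"


subsection \<open>The DG1 matrices\<close>

interpretation real_poly: vector_space "smult :: real \<Rightarrow> real poly \<Rightarrow> real poly"
  by unfold_locales (simp_all add: smult_add_right smult_add_left)

definition poly_space_basis :: "nat \<Rightarrow> (nat \<Rightarrow> real poly) \<Rightarrow> bool" where
  "poly_space_basis r \<phi> \<longleftrightarrow>
     inj_on \<phi> {..r} \<and>
     real_poly.independent (\<phi> ` {..r}) \<and>
     real_poly.span (\<phi> ` {..r}) = {p. degree p \<le> r}"

text \<open>Slab \<open>n\<close> is \<open>I_n = (t_{n-1}, t_n]\<close> with \<open>t_n = n * dt\<close>. The family \<open>\<phi>\<close> is the basis on
  \<open>I_1 = (0, dt]\<close>; the basis on slab \<open>n\<close> is its translate \<open>\<psi>_{n,j}(t) = \<phi>_j(t - t_{n-1})\<close>. The slab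
  \<open>n = 0\<close>, which carries the initial coefficients, is \<open>(-dt, 0]\<close>.\<close>

definition slab_basis :: "(nat \<Rightarrow> real poly) \<Rightarrow> real \<Rightarrow> nat \<Rightarrow> nat \<Rightarrow> real poly" where
  "slab_basis \<phi> dt n j = pcompose (\<phi> j) [:- ((real n - 1) * dt), 1:]"

text \<open>Integrals over a slab are exact or evaluated by a quadrature formula, given as a list of pairs
  (node, weight) with respect to the reference interval \<open>[0, 1]\<close>.\<close>

datatype slab_rule = Exact | Quadrature "(real \<times> real) list"

fun slab_integral :: "slab_rule \<Rightarrow> real \<Rightarrow> real \<Rightarrow> (real \<Rightarrow> real) \<Rightarrow> real" where
  "slab_integral Exact a b f = integral {a..b} f"
| "slab_integral (Quadrature qs) a b f =
     (b - a) * (\<Sum>(c, w) \<leftarrow> qs. w * f (a + c * (b - a)))"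

text \<open>The argument \<open>n\<close> refers to the time \<open>t_n\<close> separating the slabs \<open>n\<close> and \<open>n + 1\<close>.\<close>

definition dg_N0 :: "nat \<Rightarrow> (nat \<Rightarrow> real poly) \<Rightarrow> real \<Rightarrow> nat \<Rightarrow> real mat" where
  "dg_N0 r \<phi> dt n = mat (r + 1) (r + 1) (\<lambda>(i, j).
     - poly (slab_basis \<phi> dt n j) (real n * dt) * poly (slab_basis \<phi> dt (n + 1) i) (real n * dt))"

definition dg_N1 :: "slab_rule \<Rightarrow> nat \<Rightarrow> (nat \<Rightarrow> real poly) \<Rightarrow> real \<Rightarrow> nat \<Rightarrow> real mat" where
  "dg_N1 Q r \<phi> dt n = mat (r + 1) (r + 1) (\<lambda>(i, j).
     slab_integral Q (real n * dt) (real (n + 1) * dt) (\<lambda>t.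
       poly (pderiv (slab_basis \<phi> dt (n + 1) j)) t * poly (slab_basis \<phi> dt (n + 1) i) t))"

definition dg_N2 :: "slab_rule \<Rightarrow> nat \<Rightarrow> (nat \<Rightarrow> real poly) \<Rightarrow> real \<Rightarrow> nat \<Rightarrow> real mat" where
  "dg_N2 Q r \<phi> dt n = mat (r + 1) (r + 1) (\<lambda>(i, j).
     slab_integral Q (real n * dt) (real (n + 1) * dt) (\<lambda>t.
       poly (slab_basis \<phi> dt (n + 1) j) t * poly (slab_basis \<phi> dt (n + 1) i) t))"

definition dg_N3 :: "nat \<Rightarrow> (nat \<Rightarrow> real poly) \<Rightarrow> real \<Rightarrow> nat \<Rightarrow> real mat" where
  "dg_N3 r \<phi> dt n = mat (r + 1) (r + 1) (\<lambda>(i, j).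
     poly (slab_basis \<phi> dt (n + 1) j) (real n * dt) * poly (slab_basis \<phi> dt (n + 1) i) (real n * dt))"

text \<open>The rules \<open>Q1\<close> and \<open>Q2\<close> for the two integral matrices may differ.\<close>

definition dg_N4 ::
  "slab_rule \<Rightarrow> slab_rule \<Rightarrow> nat \<Rightarrow> (nat \<Rightarrow> real poly) \<Rightarrow> real \<Rightarrow> nat \<Rightarrow> real mat" where
  "dg_N4 Q1 Q2 r \<phi> dt n = mat_inv (dg_N1 Q1 r \<phi> dt n + dg_N3 r \<phi> dt n) * dg_N2 Q2 r \<phi> dt n"

definition dg_N5 :: "slab_rule \<Rightarrow> nat \<Rightarrow> (nat \<Rightarrow> real poly) \<Rightarrow> real \<Rightarrow> nat \<Rightarrow> real mat" where
  "dg_N5 Q1 r \<phi> dt n = mat_inv (dg_N1 Q1 r \<phi> dt n + dg_N3 r \<phi> dt n) * dg_N0 r \<phi> dt n"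

definition dg1_scheme ::
  "nat \<Rightarrow> real mat \<Rightarrow> real mat \<Rightarrow> real mat \<Rightarrow> nat \<Rightarrow> (nat \<Rightarrow> real vec) \<Rightarrow> bool" where
  "dg1_scheme r N4 N5 L N zh \<longleftrightarrow>
     (\<forall>n\<le>N. zh n \<in> carrier_vec (2 * (r + 1))) \<and>
     (\<forall>n<N. (kronecker (1\<^sub>m (r + 1)) (1\<^sub>m 2) - kronecker N4 L) *\<^sub>v zh (Suc n) =
            - kronecker N5 (1\<^sub>m 2) *\<^sub>v zh n)"


subsection \<open>The DG1 matrices are the same at every time step\<close>

lemma poly_slab_basis: "poly (slab_basis \<phi> dt n j) t = poly (\<phi> j) (t - (real n - 1) * dt)"
  by (simp add: slab_basis_def poly_pcompose)

lemma poly_pderiv_slab_basis: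
  "poly (pderiv (slab_basis \<phi> dt n j)) t = poly (pderiv (\<phi> j)) (t - (real n - 1) * dt)"
  by (simp add: slab_basis_def pderiv_pcompose poly_pcompose pderiv_pCons)

lemma slab_integral_translate:
  "slab_integral Q (a + c) (b + c) (\<lambda>t. f (t - c)) = slab_integral Q a b f"
proof (cases Q)
  case Exact
  then show ?thesis
    using integral_shift_Icc_real[of a b "\<lambda>t. f (t - c)" c] by (simp add: o_def)
next
  case (Quadrature qs)
  then show ?thesis by (simp add: algebra_simps)
qed

lemma dg_N0_const: "dg_N0 r \<phi> dt n = dg_N0 r \<phi> dt 0"
  by (rule eq_matI) (auto simp: dg_N0_def poly_slab_basis algebra_simps)

lemma dg_N1_const: "dg_N1 Q r \<phi> dt n = dg_N1 Q r \<phi> dt 0"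
proof (rule eq_matI)
  fix i j
  assume "i < dim_row (dg_N1 Q r \<phi> dt 0)" "j < dim_col (dg_N1 Q r \<phi> dt 0)"
  then show "dg_N1 Q r \<phi> dt n $$ (i, j) = dg_N1 Q r \<phi> dt 0 $$ (i, j)"
    using slab_integral_translate[of Q 0 "real n * dt" dt "\<lambda>t. poly (pderiv (\<phi> j)) t * poly (\<phi> i) t"]
    by (simp add: dg_N1_def poly_slab_basis poly_pderiv_slab_basis algebra_simps)
qed (auto simp: dg_N1_def)

lemma dg_N2_const: "dg_N2 Q r \<phi> dt n = dg_N2 Q r \<phi> dt 0"
proof (rule eq_matI)
  fix i j
  assume "i < dim_row (dg_N2 Q r \<phi> dt 0)" "j < dim_col (dg_N2 Q r \<phi> dt 0)"
  then show "dg_N2 Q r \<phi> dt n $$ (i, j) = dg_N2 Q r \<phi> dt 0 $$ (i, j)"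
    using slab_integral_translate[of Q 0 "real n * dt" dt "\<lambda>t. poly (\<phi> j) t * poly (\<phi> i) t"]
    by (simp add: dg_N2_def poly_slab_basis algebra_simps)
qed (auto simp: dg_N2_def)

lemma dg_N3_const: "dg_N3 r \<phi> dt n = dg_N3 r \<phi> dt 0"
  by (rule eq_matI) (auto simp: dg_N3_def poly_slab_basis algebra_simps)

lemma dg_N4_const: "dg_N4 Q1 Q2 r \<phi> dt n = dg_N4 Q1 Q2 r \<phi> dt 0"
  unfolding dg_N4_def dg_N1_const[of _ _ _ _ n] dg_N2_const[of _ _ _ _ n] dg_N3_const[of _ _ _ n] ..

lemma dg_N5_const: "dg_N5 Q1 r \<phi> dt n = dg_N5 Q1 r \<phi> dt 0"
  unfolding dg_N5_def dg_N0_const[of _ _ _ n] dg_N1_const[of _ _ _ _ n] dg_N3_const[of _ _ _ n] ..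

end

theory Submission
  imports Defs
begin

text \<open>
  The two schemes solve the same linear system in different unknowns. In a Runge--Kutta step put
  \<open>x\<^sub>i = z\<^sub>n + \<Delta>t \<Sum>\<^sub>j a\<^sub>i\<^sub>j k\<^sub>j\<close>. The stage equations say
  \<open>k\<^sub>i = L x\<^sub>i\<close>, and \<open>L\<close> is invertible because \<open>\<lambda> \<noteq> 0\<close>, so the points
  \<open>x\<^sub>i = L\<^sup>-\<^sup>1 k\<^sub>i\<close> carry the same information as the stages. They satisfy
  \<open>x\<^sub>i - \<Delta>t \<Sum>\<^sub>j a\<^sub>i\<^sub>j L x\<^sub>j = z\<^sub>n\<close>, that is,
  \<open>(I \<otimes> I - \<Delta>t A \<otimes> L) x = \<one> \<otimes> z\<^sub>n\<close> (lemma \<open>stages_solve_dg_system\<close>).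

  On the DG side the special form of \<open>N5\<close> makes the right-hand side forget everything about the
  previous slab except its last coefficient pair, which it copies into every block
  (lemma \<open>kronecker_last_column_mult_stacked\<close>). If that pair is \<open>z\<^sub>n\<close>, both systems have the
  same matrix, since \<open>N4 = \<Delta>t A\<close>, and the same right-hand side; the matrix being invertible, the
  DG coefficients on the next slab are the points \<open>x\<^sub>i\<close>.
  The condition \<open>b\<^sub>i = a\<^sub>s\<^sub>i\<close> says that the method is stiffly accurate: its last point
  \<open>x\<^sub>s\<close> already is \<open>z\<^bsub>n+1\<^esub>\<close>. Hence the last DG coefficient pair is again the
  Runge--Kutta value, and induction on \<open>n\<close> applies.
\<close>

section \<open>Kronecker products acting on stacked vectors\<close>

lemma finsum_vec_eq_vec:
  fixes f :: "'a \<Rightarrow> real vec"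
  assumes "finite F" and f: "\<And>j. j \<in> F \<Longrightarrow> f j \<in> carrier_vec n"
  shows "finsum_vec TYPE(real) n f F = vec n (\<lambda>c. \<Sum>j\<in>F. f j $ c)"
proof (rule eq_vecI)
  show "dim_vec (finsum_vec TYPE(real) n f F) = dim_vec (vec n (\<lambda>c. \<Sum>j\<in>F. f j $ c))"
    using finsum_vec_closed[of f F n] f by auto
  show "finsum_vec TYPE(real) n f F $ c = vec n (\<lambda>c. \<Sum>j\<in>F. f j $ c) $ c"
    if "c < dim_vec (vec n (\<lambda>c. \<Sum>j\<in>F. f j $ c))" for c
    using that index_finsum_vec[OF \<open>finite F\<close>, of c n f] f by auto
qed

lemma finsum_vec_cong:
  fixes f :: "'a \<Rightarrow> real vec"
  assumes F: "finite F" and g: "\<And>j. j \<in> F \<Longrightarrow> g j \<in> carrier_vec n"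
    and eq: "\<And>j. j \<in> F \<Longrightarrow> f j = g j"
  shows "finsum_vec TYPE(real) n f F = finsum_vec TYPE(real) n g F"
proof -
  have "finsum_vec TYPE(real) n f F = vec n (\<lambda>c. \<Sum>j\<in>F. f j $ c)"
    by (rule finsum_vec_eq_vec[OF F]) (simp add: g eq)
  also have "\<dots> = vec n (\<lambda>c. \<Sum>j\<in>F. g j $ c)"
    by (simp add: eq)
  also have "\<dots> = finsum_vec TYPE(real) n g F"
    by (rule finsum_vec_eq_vec[OF F g, symmetric])
  finally show ?thesis .
qed

lemma stacked_carrier [simp]: "stacked n f \<in> carrier_vec (n * 2)"
  by (simp add: stacked_def)

lemma stacked_cong: "(\<And>i. i < n \<Longrightarrow> f i = g i) \<Longrightarrow> stacked n f = stacked n g"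
  by (auto simp: stacked_def)

lemma stacked_minus:
  assumes "\<And>i. i < n \<Longrightarrow> f i \<in> carrier_vec 2" "\<And>i. i < n \<Longrightarrow> g i \<in> carrier_vec 2"
  shows "stacked n f - stacked n g = stacked n (\<lambda>i. f i - g i)"
proof (rule eq_vecI)
  fix p assume "p < dim_vec (stacked n (\<lambda>i. f i - g i))"
  then have "p < n * 2" "p div 2 < n" by (auto simp: stacked_def)
  then show "(stacked n f - stacked n g) $ p = stacked n (\<lambda>i. f i - g i) $ p"
    using assms(2)[of "p div 2"] by (simp add: stacked_def)
qed (simp add: stacked_def)

text \<open>Every vector of even dimension is stacked, so the block formulas below apply to arbitrary
  coefficient vectors of the DG scheme.\<close>

lemma stacked_blocks:
  assumes "v \<in> carrier_vec (n * 2)"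
  obtains f where "\<And>i. f i \<in> carrier_vec 2" "v = stacked n f"
proof
  show "vec 2 (\<lambda>c. v $ (i * 2 + c)) \<in> carrier_vec 2" for i by simp
  show "v = stacked n (\<lambda>i. vec 2 (\<lambda>c. v $ (i * 2 + c)))"
    using assms by (auto simp: stacked_def intro!: eq_vecI)
qed

lemma vec_last_stacked:
  assumes "f r \<in> carrier_vec 2"
  shows "vec_last (stacked (Suc r) f) 2 = f r"
proof (rule eq_vecI)
  fix c assume "c < dim_vec (f r)"
  then have "c < 2" using assms by simp
  then show "vec_last (stacked (Suc r) f) 2 $ c = f r $ c"
    by (simp add: vec_last_def stacked_def)
qed (use assms in simp)

text \<open>The rule \<open>(A \<otimes> B)(f\<^sub>j)\<^sub>j = (\<Sum>\<^sub>j a\<^sub>i\<^sub>j B f\<^sub>j)\<^sub>i\<close>, which replaces the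
  index arithmetic of the Kronecker product by sums over blocks. The proof groups
  the column indices into pairs \<open>2j, 2j + 1\<close>, one pair for each block.\<close>

lemma kronecker_mult_stacked:
  assumes A: "A \<in> carrier_mat m n" and B: "B \<in> carrier_mat 2 2"
    and f: "\<And>j. j < n \<Longrightarrow> f j \<in> carrier_vec 2"
  shows "kronecker A B *\<^sub>v stacked n f =
    stacked m (\<lambda>i. finsum_vec TYPE(real) 2 (\<lambda>j. A $$ (i, j) \<cdot>\<^sub>v (B *\<^sub>v f j)) {..<n})"
proof (rule eq_vecI)
  fix p
  assume "p < dim_vec (stacked m (\<lambda>i. finsum_vec TYPE(real) 2
    (\<lambda>j. A $$ (i, j) \<cdot>\<^sub>v (B *\<^sub>v f j)) {..<n}))"
  then have p: "p < m * 2" by (simp add: stacked_def)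
  define i c where "i = p div 2" and "c = p mod 2"
  have ic: "i < m" "c < 2" using p by (auto simp: i_def c_def)
  have "(kronecker A B *\<^sub>v stacked n f) $ p =
      (\<Sum>q<n * 2. A $$ (i, q div 2) * B $$ (c, q mod 2) * f (q div 2) $ (q mod 2))"
    using p A B by (auto simp: kronecker_def stacked_def scalar_prod_def i_def c_def
        lessThan_atLeast0 intro!: sum.cong)
  also have "\<dots> = (\<Sum>j<n. \<Sum>q = j * 2..<j * 2 + 2.
      A $$ (i, q div 2) * B $$ (c, q mod 2) * f (q div 2) $ (q mod 2))"
    by (rule sum.nat_group [symmetric])
  also have "\<dots> = (\<Sum>j<n. A $$ (i, j) * (B *\<^sub>v f j) $ c)"
  proof (rule sum.cong [OF refl])
    fix j assume "j \<in> {..<n}"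
    then have "dim_vec (f j) = 2" using f[of j] by simp
    then have "(B *\<^sub>v f j) $ c = B $$ (c, 0) * f j $ 0 + B $$ (c, 1) * f j $ 1"
      using ic B by (simp add: scalar_prod_def numeral_2_eq_2)
    moreover have "{j * 2..<j * 2 + 2} = {j * 2, Suc (j * 2)}" by auto
    moreover have "Suc (j * 2) div 2 = j" "Suc (j * 2) mod 2 = 1" by presburger+
    ultimately show "(\<Sum>q = j * 2..<j * 2 + 2.
        A $$ (i, q div 2) * B $$ (c, q mod 2) * f (q div 2) $ (q mod 2)) =
        A $$ (i, j) * (B *\<^sub>v f j) $ c"
      by (simp add: algebra_simps)
  qed
  also have "\<dots> = finsum_vec TYPE(real) 2 (\<lambda>j. A $$ (i, j) \<cdot>\<^sub>v (B *\<^sub>v f j)) {..<n} $ c"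
    using ic B f by (subst finsum_vec_eq_vec) auto
  finally show "(kronecker A B *\<^sub>v stacked n f) $ p = stacked m (\<lambda>i. finsum_vec TYPE(real) 2
      (\<lambda>j. A $$ (i, j) \<cdot>\<^sub>v (B *\<^sub>v f j)) {..<n}) $ p"
    using p by (simp add: stacked_def i_def c_def)
qed (use A B in \<open>simp_all add: stacked_def kronecker_def\<close>)

lemma kronecker_one_mult_stacked:
  assumes B: "B \<in> carrier_mat 2 2" and f: "\<And>j. j < n \<Longrightarrow> f j \<in> carrier_vec 2"
  shows "kronecker (1\<^sub>m n) B *\<^sub>v stacked n f = stacked n (\<lambda>i. B *\<^sub>v f i)"
proof -
  have "finsum_vec TYPE(real) 2 (\<lambda>j. 1\<^sub>m n $$ (i, j) \<cdot>\<^sub>v (B *\<^sub>v f j)) {..<n} = B *\<^sub>v f i"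
    if i: "i < n" for i
  proof -
    have "finsum_vec TYPE(real) 2 (\<lambda>j. 1\<^sub>m n $$ (i, j) \<cdot>\<^sub>v (B *\<^sub>v f j)) {..<n} =
        vec 2 (\<lambda>c. \<Sum>j<n. (1\<^sub>m n $$ (i, j) \<cdot>\<^sub>v (B *\<^sub>v f j)) $ c)"
      using B by (intro finsum_vec_eq_vec carrier_vecI) auto
    also have "\<dots> = vec 2 (\<lambda>c. \<Sum>j<n. if i = j then (B *\<^sub>v f j) $ c else 0)"
      using B i by (intro eq_vecI) (auto intro!: sum.cong simp del: sum.delta sum.delta')
    also have "\<dots> = B *\<^sub>v f i"
    proof (rule eq_vecI)
      show "vec 2 (\<lambda>c. \<Sum>j<n. if i = j then (B *\<^sub>v f j) $ c else 0) $ c = (B *\<^sub>v f i) $ c"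
        if "c < dim_vec (B *\<^sub>v f i)" for c
        using that B i by (simp del: index_mult_mat_vec)
    qed (use B in simp)
    finally show ?thesis .
  qed
  then show ?thesis
    by (subst kronecker_mult_stacked[OF one_carrier_mat B f]) (auto intro: stacked_cong)
qed

text \<open>This is where the DG scheme loses its memory of the previous slab: of the old coefficients,
  \<open>- N5 \<otimes> I\<close> passes on only the last block. The proof absorbs the minus sign into the matrix \<open>E\<close>
  that has ones in its last column, so that the block formula applies.\<close>

lemma kronecker_last_column_mult_stacked:
  assumes f: "\<And>j. j \<le> r \<Longrightarrow> f j \<in> carrier_vec 2"
  shows "- kronecker (mat (r + 1) (r + 1) (\<lambda>(i, j). if j = r then - 1 else 0)) (1\<^sub>m 2)
    *\<^sub>v stacked (r + 1) f = stacked (r + 1) (\<lambda>_. f r)"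
proof -
  define E :: "real mat" where "E = mat (r + 1) (r + 1) (\<lambda>(i, j). if j = r then 1 else 0)"
  have "- kronecker (mat (r + 1) (r + 1) (\<lambda>(i, j). if j = r then - 1 else 0)) (1\<^sub>m 2)
      = kronecker E (1\<^sub>m 2)"
  proof (rule eq_matI)
    fix i j
    assume "i < dim_row (kronecker E (1\<^sub>m 2))" "j < dim_col (kronecker E (1\<^sub>m 2))"
    then have "i < (r + 1) * 2" "j < (r + 1) * 2" by (auto simp: kronecker_def E_def)
    then have "i div 2 < r + 1" "j div 2 < r + 1" "i < (r + 1) * 2" "j < (r + 1) * 2"
      by (auto simp: less_mult_imp_div_less)
    then show "(- kronecker (mat (r + 1) (r + 1) (\<lambda>(i, j). if j = r then - 1 else 0)) (1\<^sub>m 2))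
        $$ (i, j) = kronecker E (1\<^sub>m 2) $$ (i, j)"
      by (auto simp: kronecker_def E_def)
  qed (auto simp: kronecker_def E_def)
  moreover have "finsum_vec TYPE(real) 2 (\<lambda>j. E $$ (i, j) \<cdot>\<^sub>v (1\<^sub>m 2 *\<^sub>v f j)) {..<r + 1} = f r"
    if i: "i < r + 1" for i
  proof -
    have "E $$ (i, j) \<cdot>\<^sub>v (1\<^sub>m 2 *\<^sub>v f j) = (if j = r then f j else 0\<^sub>v 2)" if "j < r + 1" for j
      using i that f[of j] by (auto simp: E_def)
    then have "finsum_vec TYPE(real) 2 (\<lambda>j. E $$ (i, j) \<cdot>\<^sub>v (1\<^sub>m 2 *\<^sub>v f j)) {..<r + 1} =
        vec 2 (\<lambda>c. \<Sum>j<r + 1. if j = r then f j $ c else 0)"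
      using f by (subst finsum_vec_eq_vec) (auto intro!: eq_vecI sum.cong)
    also have "\<dots> = f r"
      using f[of r] by (intro eq_vecI) auto
    finally show ?thesis .
  qed
  moreover have "E \<in> carrier_mat (r + 1) (r + 1)" by (simp add: E_def)
  ultimately show ?thesis
    using f kronecker_mult_stacked[of E "r + 1" "r + 1" "1\<^sub>m 2" f]
    by (auto intro!: stacked_cong)
qed


section \<open>Inverse matrices\<close>

text \<open>The function \<open>mat_inv\<close> is specified by Gauss--Jordan elimination; any two-sided inverse
  certifies that the elimination succeeds.\<close>

lemma mat_inv_inverse:
  assumes A: "A \<in> carrier_mat n n" and "B \<in> carrier_mat n n" "A * B = 1\<^sub>m n" "B * A = 1\<^sub>m n"
  shows "mat_inv A \<in> carrier_mat n n" "A * mat_inv A = 1\<^sub>m n" "mat_inv A * A = 1\<^sub>m n"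
proof -
  have "A \<in> Units (ring_mat TYPE(real) n ())"
    using assms by (auto simp: Units_def ring_mat_simps)
  then obtain C where "mat_inverse A = Some C"
    using mat_inverse(1)[OF A, where b = "()"] by blast
  then show "mat_inv A \<in> carrier_mat n n" "A * mat_inv A = 1\<^sub>m n" "mat_inv A * A = 1\<^sub>m n"
    using mat_inverse(2)[OF A] by (auto simp: mat_inv_def)
qed

lemma osc_mat_carrier: "osc_mat lam \<in> carrier_mat 2 2"
  by (auto simp: osc_mat_def mat_of_rows_list_def)

lemma mat_inv_osc_mat:
  assumes "lam \<noteq> 0"
  shows "mat_inv (osc_mat lam) \<in> carrier_mat 2 2"
    "osc_mat lam * mat_inv (osc_mat lam) = 1\<^sub>m 2"
    "mat_inv (osc_mat lam) * osc_mat lam = 1\<^sub>m 2"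
proof -
  let ?B = "mat_of_rows_list 2 [[0, - 1 / lam], [1, 0]]"
  have B: "?B \<in> carrier_mat 2 2" by (auto simp: mat_of_rows_list_def)
  have AB: "osc_mat lam * ?B = 1\<^sub>m 2"
    using assms by (intro eq_matI) (auto simp: osc_mat_def mat_of_rows_list_def scalar_prod_def
        numeral_2_eq_2 less_Suc_eq)
  have BA: "?B * osc_mat lam = 1\<^sub>m 2"
    using assms by (intro eq_matI) (auto simp: osc_mat_def mat_of_rows_list_def scalar_prod_def
        numeral_2_eq_2 less_Suc_eq)
  show "mat_inv (osc_mat lam) \<in> carrier_mat 2 2"
    "osc_mat lam * mat_inv (osc_mat lam) = 1\<^sub>m 2"
    "mat_inv (osc_mat lam) * osc_mat lam = 1\<^sub>m 2"
    using mat_inv_inverse[OF osc_mat_carrier B AB BA] .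
qed

lemma invertible_mat_mult_cancel:
  assumes M: "M \<in> carrier_mat n n" and "invertible_mat M"
    and x: "x \<in> carrier_vec n" and y: "y \<in> carrier_vec n" and eq: "M *\<^sub>v x = M *\<^sub>v y"
  shows "x = (y :: real vec)"
proof -
  obtain B where B: "B * M = 1\<^sub>m (dim_row B)" and MB: "M * B = 1\<^sub>m n"
    using assms(2) M by (auto simp: invertible_mat_def inverts_mat_def)
  have "dim_col B = n" using MB by (metis index_mult_mat(3) index_one_mat(3))
  moreover have "dim_row B = n"
    using B M by (metis carrier_matD(2) index_mult_mat(3) index_one_mat(3))
  ultimately have Bc: "B \<in> carrier_mat n n" by auto
  have "B * M *\<^sub>v x = B * M *\<^sub>v y"
    using Bc M x y eq by (simp add: assoc_mult_mat_vec)
  then show ?thesis using B Bc x y by simp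
qed


section \<open>The stage equations in the unknowns of the DG scheme\<close>

text \<open>Block \<open>i\<close> of the product is \<open>y\<^sub>i - \<Delta>t \<Sum>\<^sub>j a\<^sub>i\<^sub>j L y\<^sub>j\<close>, so the hypothesis on
  \<open>y\<close> is the system itself, read block by block.\<close>

lemma stages_solve_dg_system:
  fixes A L :: "real mat"
  assumes A: "A \<in> carrier_mat s s" and L: "L \<in> carrier_mat 2 2" and z: "z \<in> carrier_vec 2"
    and y: "\<And>i. i < s \<Longrightarrow> y i \<in> carrier_vec 2"
    and stage: "\<And>i. i < s \<Longrightarrow>
      y i = z + dt \<cdot>\<^sub>v finsum_vec TYPE(real) 2 (\<lambda>j. A $$ (i, j) \<cdot>\<^sub>v (L *\<^sub>v y j)) {..<s}"
  shows "(kronecker (1\<^sub>m s) (1\<^sub>m 2) - kronecker (dt \<cdot>\<^sub>m A) L) *\<^sub>v stacked s y = stacked s (\<lambda>_. z)"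
proof -
  let ?S = "\<lambda>B i. finsum_vec TYPE(real) 2 (\<lambda>j. B $$ (i, j) \<cdot>\<^sub>v (L *\<^sub>v y j)) {..<s}"
  have S: "?S B i \<in> carrier_vec 2" for B i
    using L y by (subst finsum_vec_eq_vec) auto
  have scale: "?S (dt \<cdot>\<^sub>m A) i = dt \<cdot>\<^sub>v ?S A i" if i: "i < s" for i
  proof -
    have "?S B i = vec 2 (\<lambda>c. \<Sum>j<s. B $$ (i, j) * (L *\<^sub>v y j) $ c)" for B
      using L y by (subst finsum_vec_eq_vec) (auto intro!: eq_vecI)
    then show ?thesis
      using i A by (auto simp: sum_distrib_left mult.assoc intro!: eq_vecI)
  qed
  have diff: "y i - ?S (dt \<cdot>\<^sub>m A) i = z" if i: "i < s" for i
  proof (rule eq_vecI)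
    fix c assume "c < dim_vec z"
    then show "(y i - ?S (dt \<cdot>\<^sub>m A) i) $ c = z $ c"
      using z S[of A i] by (simp add: scale[OF i]) (subst stage[OF i], simp)
  qed (use z S in simp)
  have "(kronecker (1\<^sub>m s) (1\<^sub>m 2) - kronecker (dt \<cdot>\<^sub>m A) L) *\<^sub>v stacked s y =
      kronecker (1\<^sub>m s) (1\<^sub>m 2) *\<^sub>v stacked s y - kronecker (dt \<cdot>\<^sub>m A) L *\<^sub>v stacked s y"
    using A L by (intro minus_mult_distrib_mat_vec[where nr = "s * 2" and nc = "s * 2"])
      (auto simp: kronecker_def)
  also have "\<dots> = stacked s (\<lambda>i. 1\<^sub>m 2 *\<^sub>v y i) - stacked s (?S (dt \<cdot>\<^sub>m A))"
    using y by (simp only: kronecker_one_mult_stacked[OF one_carrier_mat y]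
        kronecker_mult_stacked[OF smult_carrier_mat[OF A] L y])
  also have "\<dots> = stacked s (\<lambda>i. 1\<^sub>m 2 *\<^sub>v y i - ?S (dt \<cdot>\<^sub>m A) i)"
    using y S by (intro stacked_minus) auto
  also have "\<dots> = stacked s (\<lambda>_. z)"
    using y diff by (intro stacked_cong) auto
  finally show ?thesis .
qed


section \<open>Equivalence of the two schemes\<close>

theorem theorem8:
  fixes lam T dt :: real and r s N :: nat
    and L A N4 N5 :: "real mat" and b :: "real vec"
    and \<phi> :: "nat \<Rightarrow> real poly" and Q1 Q2 :: slab_rule
    and zh z :: "nat \<Rightarrow> real vec" and k :: "nat \<Rightarrow> nat \<Rightarrow> real vec"
  assumes "lam > 0" and L: "L = osc_mat lam" and "r \<ge> 1"
    and "T > 0" and "N \<ge> 1" and dt: "dt = T / real N"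
    and basis: "poly_space_basis r \<phi>"
    and N4: "N4 = dg_N4 Q1 Q2 r \<phi> dt 0"
    and N5: "N5 = dg_N5 Q1 r \<phi> dt 0"
    and "A \<in> carrier_mat s s" and "b \<in> carrier_vec s"
    and "s = r + 1"
    and "N4 = dt \<cdot>\<^sub>m A"
    and "\<forall>i<s. b $ i = A $$ (s - 1, i)"
    and "N5 = mat (r + 1) (r + 1) (\<lambda>(i, j). if j = r then - 1 else 0)"
    and "invertible_mat (kronecker (1\<^sub>m s) (1\<^sub>m 2) - kronecker N4 L)"
    and dg: "dg1_scheme r N4 N5 L N zh"
    and rk: "runge_kutta s A b L dt N k z"
    and init: "vec_last (zh 0) 2 = z 0"
  shows "\<forall>n\<in>{1..N}. vec_last (zh n) 2 = z n \<and>
           zh n = kronecker (1\<^sub>m (r + 1)) (mat_inv L) *\<^sub>v stacked s (k (n - 1))"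
proof -
  note A = \<open>A \<in> carrier_mat s s\<close> and s = \<open>s = r + 1\<close> and NA = \<open>N4 = dt \<cdot>\<^sub>m A\<close>
    and weights = \<open>\<forall>i<s. b $ i = A $$ (s - 1, i)\<close>
    and N5_eq = \<open>N5 = mat (r + 1) (r + 1) (\<lambda>(i, j). if j = r then - 1 else 0)\<close>
    and inv = \<open>invertible_mat (kronecker (1\<^sub>m s) (1\<^sub>m 2) - kronecker N4 L)\<close>
  have Lc: "L \<in> carrier_mat 2 2" by (simp add: L osc_mat_carrier)
  have Li: "mat_inv L \<in> carrier_mat 2 2" "L * mat_inv L = 1\<^sub>m 2" "mat_inv L * L = 1\<^sub>m 2"
    using mat_inv_osc_mat[of lam] \<open>lam > 0\<close> by (auto simp: L)
  let ?M = "kronecker (1\<^sub>m s) (1\<^sub>m 2) - kronecker N4 L"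
  have M: "?M \<in> carrier_mat (s * 2) (s * 2)"
    using A Lc by (auto simp: kronecker_def NA)
  have step: "vec_last (zh (Suc n)) 2 = z (Suc n) \<and>
      zh (Suc n) = kronecker (1\<^sub>m (r + 1)) (mat_inv L) *\<^sub>v stacked s (k n)"
    if n: "n < N" and last: "vec_last (zh n) 2 = z n" for n
  proof -
    have z: "z n \<in> carrier_vec 2" and k: "\<And>i. i < s \<Longrightarrow> k n i \<in> carrier_vec 2"
      and stage: "\<And>i. i < s \<Longrightarrow> k n i =
        L *\<^sub>v (z n + dt \<cdot>\<^sub>v finsum_vec TYPE(real) 2 (\<lambda>j. A $$ (i, j) \<cdot>\<^sub>v k n j) {..<s})"
      and update: "z (Suc n) = z n + dt \<cdot>\<^sub>v finsum_vec TYPE(real) 2 (\<lambda>i. b $ i \<cdot>\<^sub>v k n i) {..<s}"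
      using rk n unfolding runge_kutta_def by auto
    have zh: "zh n \<in> carrier_vec (s * 2)" "zh (Suc n) \<in> carrier_vec (s * 2)"
      and system: "?M *\<^sub>v zh (Suc n) = - kronecker N5 (1\<^sub>m 2) *\<^sub>v zh n"
      using dg n unfolding dg1_scheme_def s by (auto simp: mult.commute)
    \<comment> \<open>Two expressions for the same points: the stage equations give \<open>k\<^sub>i = L ?x\<^sub>i\<close>,
      hence \<open>?y\<^sub>i = ?x\<^sub>i\<close>.\<close>
    let ?x = "\<lambda>i. z n + dt \<cdot>\<^sub>v finsum_vec TYPE(real) 2 (\<lambda>j. A $$ (i, j) \<cdot>\<^sub>v k n j) {..<s}"
    let ?y = "\<lambda>i. mat_inv L *\<^sub>v k n i"
    have x: "?x i \<in> carrier_vec 2" for i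
      using z k by (subst finsum_vec_eq_vec) auto
    have y: "?y i \<in> carrier_vec 2" for i
      using Li by (intro carrier_vecI) auto
    have Ly: "L *\<^sub>v ?y i = k n i" if "i < s" for i
      using assoc_mult_mat_vec[OF Lc Li(1) k[OF that]] Li(2) k[OF that] by simp
    have yx: "?y i = ?x i" if "i < s" for i
      using assoc_mult_mat_vec[OF Li(1) Lc x, of i] Li(3) x[of i] stage[OF that] by simp
    have sum_eq: "finsum_vec TYPE(real) 2 (\<lambda>j. A $$ (i, j) \<cdot>\<^sub>v (L *\<^sub>v ?y j)) {..<s} =
        finsum_vec TYPE(real) 2 (\<lambda>j. A $$ (i, j) \<cdot>\<^sub>v k n j) {..<s}" for i
      by (intro finsum_vec_cong) (use k Ly in auto)
    have "?M *\<^sub>v stacked s ?y = stacked s (\<lambda>_. z n)"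
      unfolding NA by (rule stages_solve_dg_system[OF A Lc z y]) (simp add: sum_eq yx)
    moreover have "- kronecker N5 (1\<^sub>m 2) *\<^sub>v zh n = stacked s (\<lambda>_. z n)"
    proof -
      obtain f where f: "\<And>i. f i \<in> carrier_vec 2" "zh n = stacked s f"
        using stacked_blocks[OF zh(1)] by blast
      then show ?thesis
        using last vec_last_stacked[of f r] kronecker_last_column_mult_stacked[of r f]
        by (simp add: s N5_eq)
    qed
    ultimately have "?M *\<^sub>v zh (Suc n) = ?M *\<^sub>v stacked s ?y"
      using system by simp
    then have eq: "zh (Suc n) = stacked s ?y"
      using invertible_mat_mult_cancel[OF M inv zh(2)] by simp
    have "vec_last (zh (Suc n)) 2 = ?y r"
      using vec_last_stacked[of ?y r] y eq by (simp add: s)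
    \<comment> \<open>Stiff accuracy: with the last row of \<open>A\<close> as weights, the last point is the new value.\<close>
    also have "\<dots> = z (Suc n)"
    proof -
      have "finsum_vec TYPE(real) 2 (\<lambda>j. A $$ (r, j) \<cdot>\<^sub>v k n j) {..<s} =
          finsum_vec TYPE(real) 2 (\<lambda>i. b $ i \<cdot>\<^sub>v k n i) {..<s}"
        by (intro finsum_vec_cong) (use k weights s in auto)
      then show ?thesis using yx[of r] update s by simp
    qed
    finally show ?thesis
      using eq kronecker_one_mult_stacked[OF Li(1) k] by (simp add: s)
  qed
  have last: "vec_last (zh n) 2 = z n" if "n \<le> N" for n
    using that
  proof (induction n)
    case 0
    show ?case by (rule init)
  next
    case (Suc m)
    then have "m < N" "vec_last (zh m) 2 = z m" by auto
    then show ?case using step[of m] by blast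
  qed
  show ?thesis
  proof
    fix n assume "n \<in> {1..N}"
    then obtain m where m: "n = Suc m" "m < N" by (cases n) auto
    show "vec_last (zh n) 2 = z n \<and>
        zh n = kronecker (1\<^sub>m (r + 1)) (mat_inv L) *\<^sub>v stacked s (k (n - 1))"
      unfolding m(1) diff_Suc_1 using m(2) by (intro step last) auto
  qed
qed

end
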